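(* Let $\mathbf{H}\in\mathbb{R}^{n\times n}$ be symmetric with $\operatorname{Tr}(\mathbf{H})\ne0$ and eigenvalues ordered so that $|\lambda_1|\ge|\lambda_2|\ge\dots\ge|\lambda_n|$. Assume spectral power-law decay: there is $\alpha>\tfrac12$ such that $|\lambda_k|\le|\lambda_1|k^{-\alpha}$ for all $1\le k\le n$. Let $\varepsilon>0$ and $0<\delta<1$. Then the Rademacher diagonal estimator $\mathrm{D}^{(s)}(\mathbf{H})$ with $s$ samples is a relative $(\varepsilon,\delta)$-approximator if $$s>2\left(\frac{|\lambda_1^2|\,H_{n,2\alpha}}{\frac1n\operatorname{Tr}(\mathbf{H})^2}-1\right)\left(\frac{\ln(2n/\delta)}{\varepsilon^2}\right)=2\left(\frac{|\lambda_1^2|\,H_{n,2\alpha}}{\frac1n\left(\sum_{i=1}^n\lambda_i\right)^2}-1\right)\left(\frac{\ln(2n/\delta)}{\varepsilon^2}\right).$$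
   Context: A Rademacher vector in $\mathbb{R}^n$ has i.i.d. entries taking the values $\pm1$ with probability $\tfrac12$ each. For a matrix $\mathbf{A}\in\mathbb{R}^{n\times n}$ and an integer $s\ge1$, the Rademacher diagonal estimator is $\mathrm{D}^{(s)}(\mathbf{A})=\frac1s\sum_{k=1}^s\mathbf{z}^{(k)}\odot(\mathbf{A}\mathbf{z}^{(k)})$, where $\mathbf{z}^{(1)},\dots,\mathbf{z}^{(s)}$ are i.i.d. Rademacher vectors and $\odot$ is the entrywise product. With $\operatorname{diag}(\mathbf{A})=[A_{11},\dots,A_{nn}]^\top$, the estimator $\mathrm{D}^{(s)}(\mathbf{A})$ is a relative $(\varepsilon,\delta)$-approximator if $$\Pr\left(\|\mathrm{D}^{(s)}(\mathbf{A})-\operatorname{diag}(\mathbf{A})\|_2\le\varepsilon\|\operatorname{diag}(\mathbf{A})\|_2\right)\ge1-\delta.$$ $H_{n,t}=\sum_{k=1}^nk^{-t}$ is the generalized harmonic number (a scalar, not an entry of $\mathbf{H}$). *)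

theory Defs
  imports "HOL-Probability.Probability" "HOL-Computational_Algebra.Polynomial"
begin

definition diag_vec :: "real^'n^'n \<Rightarrow> real^'n" where
  "diag_vec A = (\<chi> i. A $ i $ i)"

definition gen_harm :: "nat \<Rightarrow> real \<Rightarrow> real" where
  "gen_harm n t = (\<Sum>k=1..n. real k powr (- t))"

definition charpoly :: "real^'n^'n \<Rightarrow> real poly" where
  "charpoly A = det (mat [:0, 1:] - map_matrix (\<lambda>a. [:a:]) A)"

lemma poly_charpoly: "poly (charpoly A) x = det (mat x - A)"
  by (simp add: charpoly_def det_def poly_sum poly_prod mat_def if_distrib cong: if_cong)
     (intro sum.cong refl arg_cong2[where f="(*)"] prod.cong; simp add: sign_def)

lemma poly_charpoly_eq_0_iff:
  fixes A :: "real^'n^'n"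
  shows "poly (charpoly A) x = 0 \<longleftrightarrow> (\<exists>v. v \<noteq> 0 \<and> A *v v = x *\<^sub>R v)"
proof -
  have eq: "(mat x - A) *v v = x *\<^sub>R v - A *v v" for v :: "real^'n"
    by (simp add: vec_eq_iff matrix_vector_mult_def mat_def sum_subtractf left_diff_distrib
          if_distrib[where f="\<lambda>c. c * _"] cong: if_cong)
  have "poly (charpoly A) x = 0 \<longleftrightarrow> \<not> (\<forall>v. (mat x - A) *v v = 0 \<longrightarrow> v = 0)"
    by (metis poly_charpoly invertible_det_nz invertible_left_inverse matrix_left_invertible_ker)
  then show ?thesis
    by (auto simp: eq)
qed

text \<open>\<open>\<mu> 1, \<dots>, \<mu> CARD('n)\<close> enumerates the eigenvalues of \<open>A\<close>, each repeated according to its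
  (algebraic) multiplicity; only the values of \<open>\<mu>\<close> at \<open>1..CARD('n)\<close> are relevant.\<close>

definition eigenvalue_enum :: "real^'n^'n \<Rightarrow> (nat \<Rightarrow> real) \<Rightarrow> bool" where
  "eigenvalue_enum A \<mu> \<longleftrightarrow> charpoly A = (\<Prod>k=1..CARD('n). [:- \<mu> k, 1:])"

definition rademacher_vector :: "'w measure \<Rightarrow> ('w \<Rightarrow> real^'n) \<Rightarrow> bool" where
  "rademacher_vector M z \<longleftrightarrow>
     prob_space.indep_vars M (\<lambda>_. borel) (\<lambda>i \<omega>. z \<omega> $ i) UNIV \<and>
     (\<forall>i. measure M {\<omega> \<in> space M. z \<omega> $ i = 1} = 1/2 \<and>
          measure M {\<omega> \<in> space M. z \<omega> $ i = -1} = 1/2)"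

definition iid_rademacher :: "'w measure \<Rightarrow> nat \<Rightarrow> (nat \<Rightarrow> 'w \<Rightarrow> real^'n) \<Rightarrow> bool" where
  "iid_rademacher M s z \<longleftrightarrow>
     prob_space.indep_vars M (\<lambda>_. borel) z {1..s} \<and> (\<forall>k\<in>{1..s}. rademacher_vector M (z k))"

text \<open>The product \<open>*\<close> of two vectors of type \<open>real^'n\<close> is the entrywise one.\<close>

definition diag_estimator ::
  "nat \<Rightarrow> (nat \<Rightarrow> 'w \<Rightarrow> real^'n) \<Rightarrow> real^'n^'n \<Rightarrow> 'w \<Rightarrow> real^'n" where
  "diag_estimator s z A \<omega> = (1 / real s) *\<^sub>R (\<Sum>k=1..s. z k \<omega> * (A *v z k \<omega>))"

definition relative_approximator ::
  "'w measure \<Rightarrow> real \<Rightarrow> real \<Rightarrow> real^'n^'n \<Rightarrow> ('w \<Rightarrow> real^'n) \<Rightarrow> bool" where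
  "relative_approximator M \<epsilon> \<delta> A D \<longleftrightarrow>
     measure M {\<omega> \<in> space M. norm (D \<omega> - diag_vec A) \<le> \<epsilon> * norm (diag_vec A)} \<ge> 1 - \<delta>"

end

theory Submission
  imports Defs "HOL-Probability.Hoeffding"
begin

text \<open>
  Since \<open>z\<^sub>i\<^sup>2 = 1\<close>, the \<open>i\<close>-th error of the estimator is the average over the samples of
  \<open>z\<^sub>i \<Sum>\<^sub>j H\<^sub>i\<^sub>j z\<^sub>j\<close> with \<open>j \<noteq> i\<close>; the products \<open>z\<^sub>i z\<^sub>j\<close> are again independent signs, so
  this error is sub-Gaussian with variance proxy \<open>\<sigma>\<^sub>i\<^sup>2 / s\<close>, where \<open>\<sigma>\<^sub>i\<^sup>2\<close> is the sum of the squared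
  off-diagonal entries of row \<open>i\<close>. Bounding each row error by a multiple of \<open>\<sigma>\<^sub>i\<close> and taking a union
  bound reduces the claim to estimating the off-diagonal Frobenius mass, which is
  \<open>tr(H\<^sup>2) - \<parallel>diag H\<parallel>\<^sup>2\<close>. Here \<open>tr(H\<^sup>2)\<close> is the sum of the squared eigenvalues, controlled by the
  decay, and \<open>\<parallel>diag H\<parallel>\<^sup>2 \<ge> tr(H)\<^sup>2 / n\<close>.

  The trace identities come from the characteristic polynomial alone: \<open>-tr A\<close> is the derivative of
  \<open>det (1 - t A)\<close> at \<open>0\<close>, and \<open>det (1 - t A) det (1 + t A) = det (1 - t\<^sup>2 A\<^sup>2)\<close>.
\<close>

section \<open>Traces as power sums of the eigenvalues\<close>

lemma has_derivative_det_affine: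
  fixes A :: "real^'n^'n"
  shows "((\<lambda>t. det (mat 1 - t *\<^sub>R A)) has_real_derivative - trace A) (at 0)"
proof -
  define f where "f p i t = (mat 1 - t *\<^sub>R A) $ i $ p i" for p :: "'n \<Rightarrow> 'n" and i and t :: real
  have f: "(f p i has_real_derivative - A $ i $ p i) (at 0)" for p i
    unfolding f_def by (auto intro!: derivative_eq_intros)
  have f0: "f p i 0 = (if p i = i then 1 else 0)" for p i
    by (auto simp: f_def mat_def)
  \<comment> \<open>Leibniz formula, differentiated permutation by permutation with the product
    rule; the undifferentiated factors are evaluated at \<open>0\<close>, where they are entries of
    the identity matrix.\<close>
  have "((\<lambda>t. det (mat 1 - t *\<^sub>R A)) has_real_derivative
      (\<Sum>p\<in>{p. p permutes UNIV}. of_int (sign p) * (\<Sum>i\<in>UNIV. - A $ i $ p i * (\<Prod>j\<in>UNIV-{i}. f p j 0)))) (at 0)"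
    unfolding det_def f_def[symmetric]
    by (intro DERIV_sum DERIV_cmult has_field_derivative_prod f)
  also have "(\<Sum>p\<in>{p. p permutes (UNIV :: 'n set)}. of_int (sign p) * (\<Sum>i\<in>UNIV. - A $ i $ p i * (\<Prod>j\<in>UNIV-{i}. f p j 0)))
     = (\<Sum>p\<in>{p. p permutes (UNIV :: 'n set)}. if p = id then - trace A else 0)"
  proof (rule sum.cong[OF refl], clarify)
    fix p :: "'n \<Rightarrow> 'n" assume p: "p permutes UNIV"
    show "of_int (sign p) * (\<Sum>i\<in>UNIV. - A $ i $ p i * (\<Prod>j\<in>UNIV-{i}. f p j 0)) = (if p = id then - trace A else 0)"
    proof (cases "p = id")
      case True
      then show ?thesis by (simp add: f0 trace_def sum_negf)
    next
      case False
      \<comment> \<open>A non-identity permutation moves at least two points, so each product still vanishes.\<close>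
      then obtain a where a: "p a \<noteq> a" by (auto simp: fun_eq_iff)
      have zero: "(\<Prod>j\<in>UNIV-{i}. f p j 0) = 0" for i
      proof -
        have "p (p a) \<noteq> p a" using a permutes_inj[OF p] by (auto dest: injD)
        then obtain j where "j \<noteq> i" "p j \<noteq> j" using a by metis
        then show ?thesis by (intro prod_zero) (auto simp: f0)
      qed
      show ?thesis unfolding zero using False by simp
    qed
  qed
  also have "\<dots> = - trace A"
    by (simp add: sum.delta finite_permutations permutes_id)
  finally show ?thesis .
qed

lemma has_derivative_prod_affine:
  fixes \<mu> :: "'k \<Rightarrow> real"
  shows "((\<lambda>t. \<Prod>k\<in>K. (1 - t * \<mu> k)) has_real_derivative - (\<Sum>k\<in>K. \<mu> k)) (at 0)"
proof -
  have "((\<lambda>t. \<Prod>k\<in>K. (1 - t * \<mu> k)) has_real_derivative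
      (\<Sum>k\<in>K. - \<mu> k * (\<Prod>j\<in>K-{k}. (1 - 0 * \<mu> j)))) (at 0)"
    by (intro has_field_derivative_prod) (auto intro!: derivative_eq_intros)
  then show ?thesis by (simp add: sum_negf)
qed

lemma det_scaleR:
  fixes A :: "real^'n^'n"
  shows "det (t *\<^sub>R A) = t ^ CARD('n) * det A"
  by (simp add: det_def prod.distrib sum_distrib_left mult_ac)

lemma one_minus_times_one_plus_matrix:
  fixes B :: "real^'n^'n"
  shows "(mat 1 - B) ** (mat 1 + B) = mat 1 - B ** B"
proof -
  have *: "(mat 1 - B) ** C = C - B ** C" for C :: "real^'n^'n"
    by (simp add: vec_eq_iff matrix_matrix_mult_def mat_def left_diff_distrib sum_subtractf
        if_distrib[where f="\<lambda>c. c * _"] cong: if_cong)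
  show ?thesis by (subst *) (simp add: matrix_add_ldistrib)
qed

text \<open>Reversal of the characteristic polynomial: scaling turns its value at \<open>1/t\<close>
  into this determinant, one factor \<open>t\<close> going to each root. At \<open>t = 0\<close>
  both sides are \<open>1\<close>.\<close>

lemma det_affine_eigenvalue_enum:
  fixes A :: "real^'n^'n"
  assumes "eigenvalue_enum A \<mu>"
  shows "det (mat 1 - t *\<^sub>R A) = (\<Prod>k=1..CARD('n). (1 - t * \<mu> k))"
proof (cases "t = 0")
  case False
  have "mat 1 - t *\<^sub>R A = t *\<^sub>R (mat (1/t) - A)"
    using False by (simp add: vec_eq_iff mat_def algebra_simps)
  then have "det (mat 1 - t *\<^sub>R A) = t ^ CARD('n) * poly (charpoly A) (1/t)"
    by (simp add: det_scaleR poly_charpoly)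
  also have "poly (charpoly A) (1/t) = (\<Prod>k=1..CARD('n). (1/t - \<mu> k))"
    using assms by (simp add: eigenvalue_enum_def poly_prod)
  also have "t ^ CARD('n) * \<dots> = (\<Prod>k=1..CARD('n). t * (1/t - \<mu> k))"
    by (simp add: prod.distrib)
  also have "\<dots> = (\<Prod>k=1..CARD('n). (1 - t * \<mu> k))"
    using False by (intro prod.cong) (auto simp: algebra_simps)
  finally show ?thesis .
qed simp

text \<open>Both sides of \<open>det_affine_eigenvalue_enum\<close> are differentiated at
  \<open>0\<close>, where the derivative is unique.\<close>

lemma trace_eq_sum_eigenvalues:
  fixes A :: "real^'n^'n"
  assumes "eigenvalue_enum A \<mu>"
  shows "trace A = (\<Sum>k=1..CARD('n). \<mu> k)"
  using DERIV_unique[OF has_derivative_det_affine[of A]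
      has_derivative_prod_affine[where K="{1..CARD('n)}" and \<mu>=\<mu>, folded det_affine_eigenvalue_enum[OF assms]]]
  by simp

lemma trace_square_eq_sum_eigenvalues:
  fixes A :: "real^'n^'n"
  assumes "eigenvalue_enum A \<mu>"
  shows "trace (A ** A) = (\<Sum>k=1..CARD('n). (\<mu> k)\<^sup>2)"
proof -
  \<comment> \<open>Multiplying the factorizations at \<open>sqrt u\<close> and
    \<open>- sqrt u\<close> leaves one factor \<open>1 - u * (\<mu> k)\<^sup>2\<close> per
    eigenvalue. The real square root restricts this to \<open>u \<ge> 0\<close>.\<close>
  have eq: "det (mat 1 - u *\<^sub>R (A ** A)) = (\<Prod>k=1..CARD('n). (1 - u * (\<mu> k)\<^sup>2))" if "u \<ge> 0" for u
  proof -
    define t where "t = sqrt u"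
    have u: "u = t * t" using that by (simp add: t_def)
    have "mat 1 - u *\<^sub>R (A ** A) = (mat 1 - t *\<^sub>R A) ** (mat 1 - (- t) *\<^sub>R A)"
      using one_minus_times_one_plus_matrix[of "t *\<^sub>R A"]
      by (simp add: u matrix_scalar_ac flip: scalar_matrix_assoc)
    then have "det (mat 1 - u *\<^sub>R (A ** A)) = (\<Prod>k=1..CARD('n). (1 - t * \<mu> k) * (1 - (- t) * \<mu> k))"
      using det_affine_eigenvalue_enum[OF assms, of t] det_affine_eigenvalue_enum[OF assms, of "-t"]
      by (simp only: det_mul prod.distrib)
    also have "\<dots> = (\<Prod>k=1..CARD('n). (1 - u * (\<mu> k)\<^sup>2))"
      by (simp add: u algebra_simps power2_eq_square)
    finally show ?thesis .
  qed
  \<comment> \<open>The identity \<open>eq\<close> is known only on a half-line, so one-sided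
    derivatives are compared; they are unique because \<open>0\<close> is a limit point of
    \<open>{0..}\<close>.\<close>
  have "- trace (A ** A) = - (\<Sum>k=1..CARD('n). (\<mu> k)\<^sup>2)"
  proof (rule has_field_derivative_unique)
    show "((\<lambda>u. det (mat 1 - u *\<^sub>R (A ** A))) has_real_derivative - trace (A ** A)) (at 0 within {0..})"
      by (rule has_field_derivative_at_within[OF has_derivative_det_affine])
    show "((\<lambda>u. det (mat 1 - u *\<^sub>R (A ** A))) has_real_derivative - (\<Sum>k=1..CARD('n). (\<mu> k)\<^sup>2)) (at 0 within {0..})"
      by (rule has_field_derivative_transform_within[OF
            has_field_derivative_at_within[OF has_derivative_prod_affine] zero_less_one])
         (auto simp: eq)
    show "at (0::real) within {0..} \<noteq> bot"
      by (simp add: at_within_Ici_at_right)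
  qed
  then show ?thesis by simp
qed

section \<open>Sub-Gaussian bounds for Rademacher variables\<close>

lemma cosh_le_exp_half_square: "(exp x + exp (- x)) / 2 \<le> exp (x\<^sup>2 / 2)" for x :: real
proof -
  have *: "(exp x + exp (- x)) / 2 \<le> exp (x\<^sup>2 / 2)" if "x \<ge> 0" for x :: real
  proof -
    \<comment> \<open>Hoeffding's estimate for a fair coin with \<open>h = 2 * x\<close>: the
      argument of \<open>ln\<close> is \<open>exp x * cosh x\<close>, and
      \<open>h\<^sup>2 / 8\<close> is \<open>x\<^sup>2 / 2\<close>. It is applied for
      \<open>h \<ge> 0\<close>; evenness covers negative \<open>x\<close>.\<close>
    have "ln (1 + 1/2 * (exp (2 * x) - 1)) \<le> x + x\<^sup>2 / 2"
      using Hoeffdings_lemma_aux[of "2 * x" "1/2"] that by (simp add: power_mult_distrib)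
    moreover have "1 + 1/2 * (exp (2 * x) - 1) > 0"
      using add_pos_pos[OF zero_less_one exp_gt_zero[of "2 * x"]] by (simp add: field_simps)
    ultimately have "1 + 1/2 * (exp (2 * x) - 1) \<le> exp (x + x\<^sup>2 / 2)"
      by (metis exp_le_cancel_iff exp_ln)
    then have "exp (- x) * ((1 + exp (2 * x)) / 2) \<le> exp (- x) * exp (x + x\<^sup>2 / 2)"
      by (intro mult_left_mono) (auto simp: field_simps)
    also have "exp (- x) * exp (x + x\<^sup>2 / 2) = exp (x\<^sup>2 / 2)"
      by (simp flip: exp_add)
    also have "exp (- x) * ((1 + exp (2 * x)) / 2) = (exp x + exp (- x)) / 2"
      by (simp add: algebra_simps flip: exp_add)
    finally show ?thesis .
  qed
  show ?thesis
    using *[of x] *[of "- x"] by (cases "x \<ge> 0") (auto simp: add.commute)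
qed

context prob_space begin

text \<open>Only the two point probabilities are given, so sign values hold almost surely: two
  disjoint events of mass \<open>1/2\<close> exhaust the space up to a null set.\<close>

lemma rademacher_AE:
  fixes X :: "'a \<Rightarrow> real"
  assumes [measurable]: "random_variable borel X"
    and X: "prob {\<omega> \<in> space M. X \<omega> = 1} = 1/2" "prob {\<omega> \<in> space M. X \<omega> = -1} = 1/2"
  shows "AE \<omega> in M. X \<omega> = 1 \<or> X \<omega> = -1"
proof -
  have "prob ({\<omega> \<in> space M. X \<omega> = 1} \<union> {\<omega> \<in> space M. X \<omega> = -1}) = 1"
    by (subst finite_measure_Union) (auto simp: X)
  then have "AE \<omega> in M. \<omega> \<in> {\<omega> \<in> space M. X \<omega> = 1} \<union> {\<omega> \<in> space M. X \<omega> = -1}"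
    by (subst (asm) prob_eq_1) auto
  then show ?thesis by eventually_elim auto
qed

lemma rademacher_expectation:
  fixes X :: "'a \<Rightarrow> real" and f :: "real \<Rightarrow> real"
  assumes [measurable]: "random_variable borel X" "f \<in> borel_measurable borel"
    and X: "prob {\<omega> \<in> space M. X \<omega> = 1} = 1/2" "prob {\<omega> \<in> space M. X \<omega> = -1} = 1/2"
  shows "integrable M (\<lambda>\<omega>. f (X \<omega>))" "expectation (\<lambda>\<omega>. f (X \<omega>)) = (f 1 + f (-1)) / 2"
proof -
  define g where "g \<omega> = f 1 * indicator {\<omega> \<in> space M. X \<omega> = 1} \<omega> +
      f (-1) * indicator {\<omega> \<in> space M. X \<omega> = -1} \<omega>" for \<omega>
  have [measurable]: "g \<in> borel_measurable M" unfolding g_def by measurable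
  have ae: "AE \<omega> in M. f (X \<omega>) = g \<omega>"
    using rademacher_AE[OF assms(1) X] AE_space
    by eventually_elim (auto simp: g_def)
  have int: "has_bochner_integral M g (f 1 * prob {\<omega> \<in> space M. X \<omega> = 1} + f (-1) * prob {\<omega> \<in> space M. X \<omega> = -1})"
    unfolding g_def
    by (intro has_bochner_integral_add has_bochner_integral_mult_right has_bochner_integral_real_indicator)
       (auto simp: emeasure_eq_measure)
  show "integrable M (\<lambda>\<omega>. f (X \<omega>))"
    by (subst integrable_cong_AE[OF _ _ ae]) (use int X in \<open>auto simp: has_bochner_integral_iff\<close>)
  show "expectation (\<lambda>\<omega>. f (X \<omega>)) = (f 1 + f (-1)) / 2"
    by (subst integral_cong_AE[OF _ _ ae]) (use int X in \<open>auto simp: has_bochner_integral_iff\<close>)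
qed

text \<open>The variance proxy of one sample's row error. Splitting on the sign of coordinate
  \<open>i\<close> uses independence of the coordinates directly, without first proving that the
  products of two coordinates are independent.\<close>

lemma rademacher_vector_offdiag_mgf:
  fixes z :: "'a \<Rightarrow> real^'n" and c :: "'n \<Rightarrow> real"
  assumes "rademacher_vector M z"
  shows "integrable M (\<lambda>\<omega>. exp (t * (z \<omega> $ i * (\<Sum>j\<in>UNIV-{i}. c j * z \<omega> $ j))))" (is ?int)
    and "expectation (\<lambda>\<omega>. exp (t * (z \<omega> $ i * (\<Sum>j\<in>UNIV-{i}. c j * z \<omega> $ j))))
       \<le> exp (t\<^sup>2 * (\<Sum>j\<in>UNIV-{i}. (c j)\<^sup>2) / 2)" (is ?le)
proof -
  have indep: "indep_vars (\<lambda>_. borel) (\<lambda>i \<omega>. z \<omega> $ i) UNIV"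
    and half: "prob {\<omega> \<in> space M. z \<omega> $ i = 1} = 1/2" "prob {\<omega> \<in> space M. z \<omega> $ i = -1} = 1/2" for i
    using assms by (auto simp: rademacher_vector_def)
  then have rv[measurable]: "random_variable borel (\<lambda>\<omega>. z \<omega> $ i)" for i
    by (auto simp: indep_vars_def)
  \<comment> \<open>For a sign \<open>z\<^sub>i\<close>, \<open>exp (z\<^sub>i y)\<close> is the sum of \<open>(1 + b z\<^sub>i) / 2 * exp (b y)\<close> over \<open>b = 1\<close> and
    \<open>b = -1\<close>; each summand is a product of functions of the separate coordinates.\<close>
  define G where "G b j x = (if j = i then (1 + b * x) / 2 else exp (t * b * c j * x))"
    for b and j :: 'n and x :: real
  have Gm[measurable]: "G b j \<in> borel_measurable borel" for b j
    unfolding G_def by (cases "j = i") simp_all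
  note E = rademacher_expectation[OF rv Gm half]
  have indepG: "indep_vars (\<lambda>_. borel) (\<lambda>j \<omega>. G b j (z \<omega> $ j)) UNIV" for b
    by (rule indep_vars_compose2[OF indep Gm])
  have intG: "integrable M (\<lambda>\<omega>. \<Prod>j\<in>UNIV. G b j (z \<omega> $ j))" for b
    by (rule indep_vars_integrable[OF _ indepG E(1)]) simp
  have prodG: "(\<Prod>j\<in>UNIV. G b j (x j)) = (1 + b * x i) / 2 * exp (t * b * (\<Sum>j\<in>UNIV-{i}. c j * x j))"
    for b and x :: "'n \<Rightarrow> real"
    by (subst prod.remove[of _ i])
       (auto simp: G_def exp_sum sum_distrib_left mult.assoc intro!: prod.cong)
  have EG: "expectation (\<lambda>\<omega>. \<Prod>j\<in>UNIV. G b j (z \<omega> $ j)) \<le> exp (t\<^sup>2 * (\<Sum>j\<in>UNIV-{i}. (c j)\<^sup>2) / 2) / 2"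
    if b: "b\<^sup>2 = 1" for b
  proof -
    have "expectation (\<lambda>\<omega>. \<Prod>j\<in>UNIV. G b j (z \<omega> $ j)) = (\<Prod>j\<in>UNIV. (G b j 1 + G b j (-1)) / 2)"
      by (subst indep_vars_lebesgue_integral[OF _ indepG E(1)]) (simp_all add: E(2))
    \<comment> \<open>Coordinate \<open>i\<close> contributes \<open>1/2\<close>, the mean of
      \<open>(1 + b) / 2\<close> and \<open>(1 - b) / 2\<close>; the other factors are hyperbolic
      cosines.\<close>
    also have "\<dots> = 1/2 * (\<Prod>j\<in>UNIV-{i}. (exp (t * b * c j) + exp (- (t * b * c j))) / 2)"
      by (subst prod.remove[of _ i]) (auto simp: G_def field_simps intro!: prod.cong)
    also have "\<dots> \<le> 1/2 * (\<Prod>j\<in>UNIV-{i}. exp ((t * b * c j)\<^sup>2 / 2))"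
      by (intro mult_left_mono prod_mono conjI cosh_le_exp_half_square) (auto simp: add_nonneg_nonneg)
    also have "(\<Prod>j\<in>UNIV-{i}. exp ((t * b * c j)\<^sup>2 / 2)) = exp (t\<^sup>2 * (\<Sum>j\<in>UNIV-{i}. (c j)\<^sup>2) / 2)"
      by (simp add: power_mult_distrib b sum_distrib_left sum_divide_distrib flip: exp_sum)
    finally show ?thesis by simp
  qed
  \<comment> \<open>The weight \<open>(1 + b * x) / 2\<close> is \<open>1\<close> when the sign
    \<open>x\<close> equals \<open>b\<close> and \<open>0\<close> otherwise, so exactly one summand
    survives.\<close>
  let ?F = "\<lambda>\<omega>. (\<Prod>j\<in>UNIV. G 1 j (z \<omega> $ j)) + (\<Prod>j\<in>UNIV. G (-1) j (z \<omega> $ j))"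
  have ae: "AE \<omega> in M. exp (t * (z \<omega> $ i * (\<Sum>j\<in>UNIV-{i}. c j * z \<omega> $ j))) = ?F \<omega>"
    using rademacher_AE[OF rv half, of i]
    by eventually_elim (auto simp: prodG)
  show ?int
    by (subst integrable_cong_AE[OF _ _ ae]) (auto intro!: intG)
  have "expectation (\<lambda>\<omega>. exp (t * (z \<omega> $ i * (\<Sum>j\<in>UNIV-{i}. c j * z \<omega> $ j)))) = expectation ?F"
    by (rule integral_cong_AE[OF _ _ ae]) measurable
  also have "\<dots> = expectation (\<lambda>\<omega>. \<Prod>j\<in>UNIV. G 1 j (z \<omega> $ j)) + expectation (\<lambda>\<omega>. \<Prod>j\<in>UNIV. G (-1) j (z \<omega> $ j))"
    by (intro Bochner_Integration.integral_add intG)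
  also have "\<dots> \<le> exp (t\<^sup>2 * (\<Sum>j\<in>UNIV-{i}. (c j)\<^sup>2) / 2)"
    using EG[of 1] EG[of "-1"] by simp
  finally show ?le .
qed

text \<open>Chernoff bound for each tail. Variance proxy \<open>0\<close> gets its own argument,
  since there the optimal parameter would divide by zero.\<close>

lemma subgaussian_tail:
  fixes W :: "'a \<Rightarrow> real"
  assumes [measurable]: "random_variable borel W"
    and int: "\<And>t. integrable M (\<lambda>\<omega>. exp (t * W \<omega>))"
    and mgf: "\<And>t. expectation (\<lambda>\<omega>. exp (t * W \<omega>)) \<le> exp (t\<^sup>2 * v / 2)"
    and "v \<ge> 0" "r > 0"
  shows "prob {\<omega> \<in> space M. \<bar>W \<omega>\<bar> > r * sqrt v} \<le> 2 * exp (- (r\<^sup>2 / 2))"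
proof (cases "v = 0")
  case True
  \<comment> \<open>With \<open>v = 0\<close> both \<open>exp (W \<omega>)\<close> and
    \<open>exp (- W \<omega>)\<close> have mean at most \<open>1\<close>, so this nonnegative
    function has mean \<open>0\<close>; it vanishes only where
    \<open>W \<omega> = 0\<close>.\<close>
  have i: "integrable M (\<lambda>\<omega>. exp (W \<omega>) + exp (- W \<omega>) - 2)"
    using int[of 1] int[of "-1"] by auto
  have pos: "exp w + exp (- w) - 2 \<ge> 0" for w :: real
    using exp_ge_add_one_self[of w] exp_ge_add_one_self[of "- w"] by linarith
  have "expectation (\<lambda>\<omega>. exp (W \<omega>) + exp (- W \<omega>) - 2) \<le> 0"
    using mgf[of 1] mgf[of "-1"] int[of 1] int[of "-1"] True by (simp add: prob_space)
  moreover have "expectation (\<lambda>\<omega>. exp (W \<omega>) + exp (- W \<omega>) - 2) \<ge> 0"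
    using pos by (intro integral_nonneg_AE AE_I2)
  ultimately have "expectation (\<lambda>\<omega>. exp (W \<omega>) + exp (- W \<omega>) - 2) = 0" by simp
  then have "AE \<omega> in M. exp (W \<omega>) + exp (- W \<omega>) - 2 = 0"
    using integral_nonneg_eq_0_iff_AE[OF i] pos by simp
  then have "AE \<omega> in M. W \<omega> = 0"
  proof eventually_elim
    case (elim \<omega>)
    have "(exp (W \<omega>) - 1)\<^sup>2 = exp (W \<omega>) * (exp (W \<omega>) + exp (- W \<omega>) - 2)"
      by (simp add: power2_eq_square algebra_simps flip: exp_add)
    then show ?case using elim by simp
  qed
  then have "prob {\<omega> \<in> space M. \<bar>W \<omega>\<bar> > r * sqrt v} = 0"
    using True by (subst prob_eq_0) auto
  then show ?thesis by simp
next
  case False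
  then have "v > 0" using \<open>v \<ge> 0\<close> by simp
  have tail: "prob {\<omega> \<in> space M. b * W \<omega> \<ge> r * sqrt v} \<le> exp (- (r\<^sup>2 / 2))" if b: "b\<^sup>2 = 1" for b
  proof -
    \<comment> \<open>Minimizer of the Chernoff exponent
      \<open>- t * r * sqrt v + t\<^sup>2 * v / 2\<close>, whose minimum is
      \<open>- (r\<^sup>2 / 2)\<close>.\<close>
    define t where "t = r / sqrt v"
    have "t > 0" using \<open>v > 0\<close> \<open>r > 0\<close> by (simp add: t_def)
    have i: "integrable M (\<lambda>\<omega>. exp (t * (b * W \<omega>)))"
      using int[of "t * b"] by (simp add: mult.assoc)
    have "prob {\<omega> \<in> space M. b * W \<omega> \<ge> r * sqrt v}
        \<le> exp (- t * (r * sqrt v)) * (LINT \<omega>:space M|M. exp (t * (b * W \<omega>)))"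
      using \<open>t > 0\<close>
      by (intro Chernoff_ineq_ge sets.top) (simp_all only: set_integrable_def integrable_mult_indicator[OF sets.top i])
    also have "(LINT \<omega>:space M|M. exp (t * (b * W \<omega>))) = expectation (\<lambda>\<omega>. exp (t * b * W \<omega>))"
      using i by (simp add: set_integral_space mult.assoc)
    also have "exp (- t * (r * sqrt v)) * \<dots> \<le> exp (- t * (r * sqrt v)) * exp ((t * b)\<^sup>2 * v / 2)"
      by (intro mult_left_mono mgf) simp
    also have "\<dots> = exp (- r\<^sup>2) * exp (r\<^sup>2 / 2)"
      using \<open>v > 0\<close> b by (simp add: t_def power_mult_distrib power_divide power2_eq_square[of r])
    also have "\<dots> = exp (- (r\<^sup>2 / 2))"
      by (simp flip: exp_add)
    finally show ?thesis .
  qed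
  have "prob {\<omega> \<in> space M. \<bar>W \<omega>\<bar> > r * sqrt v}
      \<le> prob ({\<omega> \<in> space M. 1 * W \<omega> \<ge> r * sqrt v} \<union> {\<omega> \<in> space M. -1 * W \<omega> \<ge> r * sqrt v})"
    by (intro finite_measure_mono) auto
  also have "\<dots> \<le> prob {\<omega> \<in> space M. 1 * W \<omega> \<ge> r * sqrt v} + prob {\<omega> \<in> space M. -1 * W \<omega> \<ge> r * sqrt v}"
    by (intro measure_Un_le) measurable
  finally show ?thesis using tail[of 1] tail[of "-1"] by simp
qed

section \<open>Row errors of the diagonal estimator\<close>

lemma diag_estimator_component_mgf:
  fixes z :: "nat \<Rightarrow> 'a \<Rightarrow> real^'n" and A :: "real^'n^'n"
  assumes z: "iid_rademacher M s z" and "s \<ge> 1"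
  defines "W \<equiv> \<lambda>i \<omega>. (diag_estimator s z A \<omega> - diag_vec A) $ i"
  shows "random_variable borel (W i)"
    and "integrable M (\<lambda>\<omega>. exp (t * W i \<omega>))"
    and "expectation (\<lambda>\<omega>. exp (t * W i \<omega>)) \<le> exp (t\<^sup>2 * ((\<Sum>j\<in>UNIV-{i}. (A $ i $ j)\<^sup>2) / real s) / 2)"
proof -
  have indep: "indep_vars (\<lambda>_. borel) z {1..s}"
    using z by (simp add: iid_rademacher_def)
  have rad: "rademacher_vector M (z k)" if "k \<in> {1..s}" for k
    using z that by (auto simp: iid_rademacher_def)
  have rv: "random_variable borel (\<lambda>\<omega>. z k \<omega> $ i)" if "k \<in> {1..s}" for k i
    using rad[OF that] by (auto simp: rademacher_vector_def indep_vars_def)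
  have W: "W i \<omega> = 1 / real s * (\<Sum>k=1..s. z k \<omega> $ i * (\<Sum>j\<in>UNIV. A $ i $ j * z k \<omega> $ j)) - A $ i $ i" for i \<omega>
    by (simp add: W_def diag_estimator_def diag_vec_def matrix_vector_mult_def)
  show Wm: "random_variable borel (W i)" for i
    unfolding W by (intro borel_measurable_diff borel_measurable_times borel_measurable_sum borel_measurable_const rv)
  define Y where "Y k \<omega> = z k \<omega> $ i * (\<Sum>j\<in>UNIV-{i}. A $ i $ j * z k \<omega> $ j)" for k \<omega>
  have "AE \<omega> in M. \<forall>k\<in>{1..s}. z k \<omega> $ i = 1 \<or> z k \<omega> $ i = -1"
    using rad by (subst AE_ball_countable)
      (auto simp: rademacher_vector_def intro!: rademacher_AE rv)
  \<comment> \<open>Since the square of a sign is \<open>1\<close>, each sample contributes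
    \<open>A $ i $ i + Y k \<omega>\<close>; averaging cancels the true diagonal entry and leaves
    the mean of the \<open>Y k \<omega>\<close>.\<close>
  then have ae: "AE \<omega> in M. exp (t * W i \<omega>) = (\<Prod>k=1..s. exp (t / real s * Y k \<omega>))" for t
  proof eventually_elim
    case (elim \<omega>)
    have "z k \<omega> $ i * (\<Sum>j\<in>UNIV. A $ i $ j * z k \<omega> $ j) = A $ i $ i + Y k \<omega>" if "k \<in> {1..s}" for k
    proof -
      have "(\<Sum>j\<in>UNIV. A $ i $ j * z k \<omega> $ j) = A $ i $ i * z k \<omega> $ i + (\<Sum>j\<in>UNIV-{i}. A $ i $ j * z k \<omega> $ j)"
        by (rule sum.remove) auto
      moreover have "z k \<omega> $ i * z k \<omega> $ i = 1" using elim that by fastforce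
      ultimately show ?thesis by (simp add: Y_def algebra_simps)
    qed
    then have "W i \<omega> = 1 / real s * (\<Sum>k=1..s. Y k \<omega>)"
      using \<open>s \<ge> 1\<close> by (simp add: W sum.distrib field_simps)
    then have "t * W i \<omega> = t / real s * (\<Sum>k=1..s. Y k \<omega>)"
      by simp
    then have "t * W i \<omega> = (\<Sum>k=1..s. t / real s * Y k \<omega>)"
      by (simp only: sum_distrib_left)
    then show ?case by (simp only: exp_sum finite_atLeastAtMost)
  qed
  \<comment> \<open>The exponentials are continuous functions of the vectors
    \<open>z k \<omega>\<close>, so they inherit independence across samples.\<close>
  have indepY: "indep_vars (\<lambda>_. borel) (\<lambda>k \<omega>. exp (t * Y k \<omega>)) {1..s}" for t
    unfolding Y_def
    by (rule indep_vars_compose2[OF indep, where Y="\<lambda>_ v. exp (t * (v $ i * (\<Sum>j\<in>UNIV-{i}. A $ i $ j * v $ j)))"])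
       (intro borel_measurable_continuous_onI continuous_intros)
  have EY: "integrable M (\<lambda>\<omega>. exp (t * Y k \<omega>))"
    "expectation (\<lambda>\<omega>. exp (t * Y k \<omega>)) \<le> exp (t\<^sup>2 * (\<Sum>j\<in>UNIV-{i}. (A $ i $ j)\<^sup>2) / 2)"
    if "k \<in> {1..s}" for k t
    unfolding Y_def using rademacher_vector_offdiag_mgf[OF rad[OF that]] by auto
  have intP: "integrable M (\<lambda>\<omega>. \<Prod>k=1..s. exp (t * Y k \<omega>))" for t
    by (rule indep_vars_integrable[OF _ indepY EY(1)]) auto
  show "integrable M (\<lambda>\<omega>. exp (t * W i \<omega>))"
    using Wm by (intro iffD2[OF integrable_cong_AE[OF _ borel_measurable_integrable[OF intP] ae] intP]) simp
  have "expectation (\<lambda>\<omega>. exp (t * W i \<omega>)) = expectation (\<lambda>\<omega>. \<Prod>k=1..s. exp (t / real s * Y k \<omega>))"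
    using intP[of "t / real s"] Wm by (intro integral_cong_AE[OF _ _ ae]) auto
  also have "\<dots> = (\<Prod>k=1..s. expectation (\<lambda>\<omega>. exp (t / real s * Y k \<omega>)))"
    by (rule indep_vars_lebesgue_integral[OF _ indepY EY(1)]) auto
  also have "\<dots> \<le> (\<Prod>k=1..s. exp ((t / real s)\<^sup>2 * (\<Sum>j\<in>UNIV-{i}. (A $ i $ j)\<^sup>2) / 2))"
    by (intro prod_mono conjI EY) auto
  \<comment> \<open>There are \<open>s\<close> equal factors with parameter \<open>t / s\<close>,
    and \<open>s * (t / s)\<^sup>2 = t\<^sup>2 / s\<close>: averaging divides the variance proxy by
    \<open>s\<close>.\<close>
  also have "\<dots> = exp (t\<^sup>2 * ((\<Sum>j\<in>UNIV-{i}. (A $ i $ j)\<^sup>2) / real s) / 2)"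
    using \<open>s \<ge> 1\<close> by (simp add: power_divide power2_eq_square field_simps flip: exp_of_nat_mult)
  finally show "expectation (\<lambda>\<omega>. exp (t * W i \<omega>)) \<le> exp (t\<^sup>2 * ((\<Sum>j\<in>UNIV-{i}. (A $ i $ j)\<^sup>2) / real s) / 2)" .
qed

text \<open>Union bound over the rows, each allowed failure probability
  \<open>\<delta> / CARD('n)\<close>; on the remaining event the squared row bounds add up to the
  norm bound. The sample condition is multiplied out to avoid dividing by the norm of the
  diagonal.\<close>

lemma relative_approximator_diag_estimator:
  fixes z :: "nat \<Rightarrow> 'a \<Rightarrow> real^'n" and A :: "real^'n^'n"
  assumes z: "iid_rademacher M s z" and "s \<ge> 1" and "0 < \<delta>" "\<delta> < 1" and "\<epsilon> \<ge> 0"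
    and s: "2 * ln (2 * real CARD('n) / \<delta>) * (\<Sum>i\<in>UNIV. \<Sum>j\<in>UNIV-{i}. (A $ i $ j)\<^sup>2)
      \<le> real s * \<epsilon>\<^sup>2 * (norm (diag_vec A))\<^sup>2"
  shows "relative_approximator M \<epsilon> \<delta> A (diag_estimator s z A)"
proof -
  define L where "L = ln (2 * real CARD('n) / \<delta>)"
  \<comment> \<open>Solves \<open>2 * exp (- (r\<^sup>2 / 2)) = \<delta> / CARD('n)\<close>.\<close>
  define r where "r = sqrt (2 * L)"
  define W where "W i \<omega> = (diag_estimator s z A \<omega> - diag_vec A) $ i" for i \<omega>
  define v where "v i = (\<Sum>j\<in>UNIV-{i}. (A $ i $ j)\<^sup>2) / real s" for i
  have n: "real CARD('n) \<ge> 1" by (simp add: Suc_leI)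
  then have "\<delta> < 2 * real CARD('n)" using \<open>\<delta> < 1\<close> by linarith
  then have "2 * real CARD('n) / \<delta> > 1" using \<open>0 < \<delta>\<close> by (simp add: less_divide_eq)
  then have "L > 0" by (simp add: L_def)
  then have r: "r > 0" "r\<^sup>2 = 2 * L" by (simp_all add: r_def)
  have v0: "v i \<ge> 0" for i by (simp add: v_def sum_nonneg)
  note mgf = diag_estimator_component_mgf[OF z \<open>s \<ge> 1\<close>, where A=A, folded W_def v_def]
  have Wm[measurable]: "random_variable borel (W i)" for i
    by (rule mgf(1))
  define B where "B i = {\<omega> \<in> space M. \<bar>W i \<omega>\<bar> > r * sqrt (v i)}" for i
  have Bm: "B i \<in> events" for i unfolding B_def by measurable
  have "prob (B i) \<le> \<delta> / real CARD('n)" for i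
  proof -
    have "prob (B i) \<le> 2 * exp (- (r\<^sup>2 / 2))"
      unfolding B_def by (rule subgaussian_tail[OF Wm mgf(2,3) v0 r(1)])
    also have "\<dots> = \<delta> / real CARD('n)"
      using \<open>0 < \<delta>\<close> by (simp add: r L_def exp_minus)
    finally show ?thesis .
  qed
  then have "(\<Sum>i\<in>UNIV. prob (B i)) \<le> real CARD('n) * (\<delta> / real CARD('n))"
    by (intro sum_bounded_above) auto
  moreover have "prob (\<Union>i. B i) \<le> (\<Sum>i\<in>UNIV. prob (B i))"
    using Bm by (intro finite_measure_subadditive_finite) auto
  ultimately have "prob (\<Union>i. B i) \<le> \<delta>" by simp
  then have "1 - \<delta> \<le> prob (space M - (\<Union>i. B i))"
    using Bm by (subst prob_compl) auto
  also have "\<dots> \<le> prob {\<omega> \<in> space M. norm (diag_estimator s z A \<omega> - diag_vec A) \<le> \<epsilon> * norm (diag_vec A)}"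
  proof (rule finite_measure_mono)
    show "space M - (\<Union>i. B i) \<subseteq> {\<omega> \<in> space M. norm (diag_estimator s z A \<omega> - diag_vec A) \<le> \<epsilon> * norm (diag_vec A)}"
    proof clarify
      fix \<omega> assume \<omega>: "\<omega> \<in> space M" "\<omega> \<notin> (\<Union>i. B i)"
      have "(W i \<omega>)\<^sup>2 \<le> 2 * L * v i" for i
      proof -
        have "\<bar>W i \<omega>\<bar> \<le> r * sqrt (v i)" using \<omega> by (auto simp: B_def not_less)
        then have "\<bar>W i \<omega>\<bar>\<^sup>2 \<le> (r * sqrt (v i))\<^sup>2" by (intro power_mono) auto
        then show ?thesis using v0[of i] r by (simp add: power_mult_distrib)
      qed
      then have "(\<Sum>i\<in>UNIV. (W i \<omega>)\<^sup>2) \<le> (\<Sum>i\<in>UNIV. 2 * L * v i)" by (intro sum_mono)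
      also have "\<dots> = 2 * L * (\<Sum>i\<in>UNIV. \<Sum>j\<in>UNIV-{i}. (A $ i $ j)\<^sup>2) / real s"
        by (simp add: v_def sum_distrib_left sum_divide_distrib)
      also have "\<dots> \<le> \<epsilon>\<^sup>2 * (norm (diag_vec A))\<^sup>2"
        using s \<open>s \<ge> 1\<close> by (simp add: L_def divide_le_eq mult_ac)
      also have "(\<Sum>i\<in>UNIV. (W i \<omega>)\<^sup>2) = (norm (diag_estimator s z A \<omega> - diag_vec A))\<^sup>2"
        by (simp add: W_def norm_vec_def L2_set_def sum_nonneg)
      finally have "(norm (diag_estimator s z A \<omega> - diag_vec A))\<^sup>2 \<le> (\<epsilon> * norm (diag_vec A))\<^sup>2"
        by (simp only: power_mult_distrib)
      then show "norm (diag_estimator s z A \<omega> - diag_vec A) \<le> \<epsilon> * norm (diag_vec A)"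
        using \<open>\<epsilon> \<ge> 0\<close> by (rule power2_le_imp_le[OF _ mult_nonneg_nonneg]) simp
    qed
    have "{\<omega> \<in> space M. norm (diag_estimator s z A \<omega> - diag_vec A) \<le> \<epsilon> * norm (diag_vec A)}
        = {\<omega> \<in> space M. sqrt (\<Sum>i\<in>UNIV. (W i \<omega>)\<^sup>2) \<le> \<epsilon> * norm (diag_vec A)}"
      by (simp add: W_def norm_vec_def L2_set_def)
    also have "\<dots> \<in> events" by measurable
    finally show "{\<omega> \<in> space M. norm (diag_estimator s z A \<omega> - diag_vec A) \<le> \<epsilon> * norm (diag_vec A)} \<in> events" .
  qed
  finally show ?thesis by (simp add: relative_approximator_def)
qed

end

section \<open>From eigenvalue decay to the sample bound\<close>

lemma trace_square_le:
  fixes A :: "real^'n^'n"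
  shows "(trace A)\<^sup>2 \<le> real CARD('n) * (norm (diag_vec A))\<^sup>2"
  \<comment> \<open>Cauchy-Schwarz for the diagonal against the all-ones vector.\<close>
  using Cauchy_Schwarz_ineq_sum[of "\<lambda>_. 1" "\<lambda>i. A $ i $ i" "UNIV :: 'n set"]
  by (simp add: trace_def diag_vec_def norm_vec_def L2_set_def sum_nonneg)

text \<open>By symmetry \<open>A ** A\<close> is \<open>A ** transpose A\<close>, whose trace is the
  squared Frobenius norm.\<close>

lemma sum_offdiag_squares:
  fixes A :: "real^'n^'n"
  assumes "transpose A = A"
  shows "(\<Sum>i\<in>UNIV. \<Sum>j\<in>UNIV-{i}. (A $ i $ j)\<^sup>2) = trace (A ** A) - (norm (diag_vec A))\<^sup>2"
proof -
  have "trace (A ** A) = trace (A ** transpose A)"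
    by (simp add: assms)
  also have "\<dots> = (\<Sum>i\<in>UNIV. \<Sum>j\<in>UNIV. (A $ i $ j)\<^sup>2)"
    by (simp add: trace_def matrix_matrix_mult_def transpose_def power2_eq_square)
  finally have "trace (A ** A) = (\<Sum>i\<in>UNIV. \<Sum>j\<in>UNIV. (A $ i $ j)\<^sup>2)" .
  moreover have "(\<Sum>j\<in>UNIV. (A $ i $ j)\<^sup>2) = (A $ i $ i)\<^sup>2 + (\<Sum>j\<in>UNIV-{i}. (A $ i $ j)\<^sup>2)" for i
    by (rule sum.remove) auto
  ultimately show ?thesis
    by (simp add: sum.distrib diag_vec_def norm_vec_def L2_set_def sum_nonneg)
qed

theorem theorem11:
  fixes M :: "'w measure" and z :: "nat \<Rightarrow> 'w \<Rightarrow> real^'n" and H :: "real^'n^'n"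
    and \<mu> :: "nat \<Rightarrow> real" and \<alpha> \<epsilon> \<delta> :: real and s :: nat
  assumes "prob_space M"
    and "transpose H = H"
    and "trace H \<noteq> 0"
    and "eigenvalue_enum H \<mu>"
    and "\<And>i j. 1 \<le> i \<Longrightarrow> i \<le> j \<Longrightarrow> j \<le> CARD('n) \<Longrightarrow> \<bar>\<mu> i\<bar> \<ge> \<bar>\<mu> j\<bar>"
    and "\<alpha> > 1/2"
    and "\<And>k. 1 \<le> k \<Longrightarrow> k \<le> CARD('n) \<Longrightarrow> \<bar>\<mu> k\<bar> \<le> \<bar>\<mu> 1\<bar> * real k powr (- \<alpha>)"
    and "\<epsilon> > 0" and "0 < \<delta>" and "\<delta> < 1"
    and "s \<ge> 1"
    and "iid_rademacher M s z"
  shows "2 * (\<bar>(\<mu> 1)\<^sup>2\<bar> * gen_harm CARD('n) (2 * \<alpha>) / ((1 / real CARD('n)) * (trace H)\<^sup>2) - 1)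
             * (ln (2 * real CARD('n) / \<delta>) / \<epsilon>\<^sup>2)
         = 2 * (\<bar>(\<mu> 1)\<^sup>2\<bar> * gen_harm CARD('n) (2 * \<alpha>) / ((1 / real CARD('n)) * (\<Sum>i=1..CARD('n). \<mu> i)\<^sup>2) - 1)
             * (ln (2 * real CARD('n) / \<delta>) / \<epsilon>\<^sup>2)
       \<and> (real s > 2 * (\<bar>(\<mu> 1)\<^sup>2\<bar> * gen_harm CARD('n) (2 * \<alpha>) / ((1 / real CARD('n)) * (trace H)\<^sup>2) - 1)
             * (ln (2 * real CARD('n) / \<delta>) / \<epsilon>\<^sup>2)
          \<longrightarrow> relative_approximator M \<epsilon> \<delta> H (diag_estimator s z H))"
proof (intro conjI impI)
  show "2 * (\<bar>(\<mu> 1)\<^sup>2\<bar> * gen_harm CARD('n) (2 * \<alpha>) / ((1 / real CARD('n)) * (trace H)\<^sup>2) - 1)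
             * (ln (2 * real CARD('n) / \<delta>) / \<epsilon>\<^sup>2)
         = 2 * (\<bar>(\<mu> 1)\<^sup>2\<bar> * gen_harm CARD('n) (2 * \<alpha>) / ((1 / real CARD('n)) * (\<Sum>i=1..CARD('n). \<mu> i)\<^sup>2) - 1)
             * (ln (2 * real CARD('n) / \<delta>) / \<epsilon>\<^sup>2)"
    using trace_eq_sum_eigenvalues[OF assms(4)] by simp
next
  \<comment> \<open>\<open>P\<close> will bound \<open>trace (H ** H)\<close> from above, and
    \<open>T\<close> will bound \<open>D\<close> from below.\<close>
  define P where "P = \<bar>(\<mu> 1)\<^sup>2\<bar> * gen_harm CARD('n) (2 * \<alpha>)"
  define T where "T = (1 / real CARD('n)) * (trace H)\<^sup>2"
  define L where "L = ln (2 * real CARD('n) / \<delta>)"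
  define D where "D = (norm (diag_vec H))\<^sup>2"
  assume "real s > 2 * (\<bar>(\<mu> 1)\<^sup>2\<bar> * gen_harm CARD('n) (2 * \<alpha>) / ((1 / real CARD('n)) * (trace H)\<^sup>2) - 1)
             * (ln (2 * real CARD('n) / \<delta>) / \<epsilon>\<^sup>2)"
  then have s: "real s > 2 * (P / T - 1) * (L / \<epsilon>\<^sup>2)"
    by (simp only: P_def T_def L_def)
  have "real CARD('n) \<ge> 1" by (simp add: Suc_leI)
  then have "\<delta> \<le> 2 * real CARD('n)" using assms(10) by linarith
  then have "L \<ge> 0" unfolding L_def using assms(9) by (intro ln_ge_zero) (simp add: le_divide_eq)
  have "T > 0" using assms(3) by (simp add: T_def)
  have "T \<le> D" using trace_square_le[of H] by (simp add: T_def D_def divide_le_eq mult.commute)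
  have "P \<ge> 0" by (auto simp: P_def gen_harm_def intro!: mult_nonneg_nonneg sum_nonneg)
  have "trace (H ** H) = (\<Sum>k=1..CARD('n). (\<mu> k)\<^sup>2)"
    by (rule trace_square_eq_sum_eigenvalues[OF assms(4)])
  also have "\<dots> \<le> (\<Sum>k=1..CARD('n). (\<mu> 1)\<^sup>2 * real k powr (- (2 * \<alpha>)))"
  proof (rule sum_mono)
    fix k assume "k \<in> {1..CARD('n)}"
    \<comment> \<open>Squaring the decay doubles the exponent, hence the parameter
      \<open>2 * \<alpha>\<close> of the harmonic number.\<close>
    then have "\<bar>\<mu> k\<bar>\<^sup>2 \<le> (\<bar>\<mu> 1\<bar> * real k powr (- \<alpha>))\<^sup>2"
      by (intro power_mono assms(7)) auto
    also have "\<dots> = (\<mu> 1)\<^sup>2 * real k powr (- (2 * \<alpha>))"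
      by (simp add: power_mult_distrib power2_eq_square[of "real k powr (- \<alpha>)"] flip: powr_add)
    finally show "(\<mu> k)\<^sup>2 \<le> (\<mu> 1)\<^sup>2 * real k powr (- (2 * \<alpha>))" by simp
  qed
  also have "\<dots> = P" by (simp add: P_def gen_harm_def sum_distrib_left)
  \<comment> \<open>\<open>P - D\<close> is written as \<open>(P / D - 1) * D\<close> so that the
    smaller \<open>T\<close> can replace \<open>D\<close> in the denominator alone.\<close>
  finally have "trace (H ** H) - D \<le> (P / D - 1) * D"
    using \<open>T > 0\<close> \<open>T \<le> D\<close> by (simp add: algebra_simps)
  also have "\<dots> \<le> (P / T - 1) * D"
    using \<open>T > 0\<close> \<open>T \<le> D\<close> \<open>P \<ge> 0\<close> by (intro mult_right_mono diff_right_mono divide_left_mono) auto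
  finally have "2 * L * (trace (H ** H) - D) \<le> 2 * L * ((P / T - 1) * D)"
    using \<open>L \<ge> 0\<close> by (intro mult_left_mono) auto
  also have "\<dots> = 2 * (P / T - 1) * (L / \<epsilon>\<^sup>2) * (\<epsilon>\<^sup>2 * D)"
    using assms(8) by simp
  also have "\<dots> \<le> real s * (\<epsilon>\<^sup>2 * D)"
    using s by (intro mult_right_mono) (auto simp: D_def)
  finally have "2 * L * (trace (H ** H) - D) \<le> real s * \<epsilon>\<^sup>2 * D"
    by (simp add: mult.assoc)
  then show "relative_approximator M \<epsilon> \<delta> H (diag_estimator s z H)"
    using assms(8-10)
    by (intro prob_space.relative_approximator_diag_estimator[OF assms(1,12,11)])
      (auto simp: sum_offdiag_squares[OF assms(2)] D_def L_def)
qed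

end
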